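(* Let $G$ be a finite simple graph that is Z-insensitive. Then $\gamma_{Zg}(G)=\gamma_g(G)$ and $\gamma_{Zg}'(G)=\gamma_g'(G)$.
   Context: Graphs are finite and simple. $N(v)$ and $N[v]=N(v)\cup\{v\}$ denote the open and closed neighborhood of a vertex $v$, and $N[D]=\bigcup_{v\in D}N[v]$ for $D\subseteq V(G)$. Z-insensitive graphs: for $A\subseteq V(G)$, let $G|A$ denote the partially dominated graph in which the vertices of $A$ are considered already dominated. $G|A$ has a Z-configuration if there is a vertex $v\in V(G)\setminus A$ such that $N(v)\subseteq A$ and $|N(u)\setminus A|\ge 2$ for each $u\in N(v)$. A graph $G$ without isolated vertices is Z-insensitive if for every $D\subseteq V(G)$ the partially dominated graph $G|N[D]$ has no Z-configuration. Games: two players, Dominator and Staller, alternately select vertices $v_1,v_2,\ldots$ of an isolate-free graph $G$. In the domination game the $i$-th move $v_i$ is legal if $N[v_i]\setminus\bigcup_{j=1}^{i-1}N[v_j]\neq\emptyset$. In the Z-domination game the $i$-th move $v_i$ is legal if $N(v_i)\setminus\bigcup_{j=1}^{i-1}N[v_j]\neq\emptyset$. Each game ends when no legal move is available. Dominator wants to minimize the total number of moves, Staller wants to maximize it. When both players play optimally, the total number of moves played (by both players) is, in the domination game, $\gamma_g(G)$ if Dominator moves first and $\gamma_g'(G)$ if Staller moves first; and in the Z-domination game, $\gamma_{Zg}(G)$ if Dominator moves first and $\gamma_{Zg}'(G)$ if Staller moves first. *)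

theory Defs
  imports "Graph_Theory.Pair_Digraph"
begin

datatype game = Domination | Z_Domination

datatype player = Dominator | Staller

text \<open>
  The locale \<^locale>\<open>pair_graph\<close> is that of finite simple graphs: an edge is a pair of opposite
  arcs, and there are no loops and no parallel arcs.
\<close>

context pair_graph
begin

definition open_nbhd :: "'a \<Rightarrow> 'a set" where
  "open_nbhd v = {u. (v, u) \<in> parcs G}"

definition closed_nbhd :: "'a \<Rightarrow> 'a set" where
  "closed_nbhd v = insert v (open_nbhd v)"

definition closed_nbhd_set :: "'a set \<Rightarrow> 'a set" where
  "closed_nbhd_set D = (\<Union>v\<in>D. closed_nbhd v)"

definition isolate_free :: bool where
  "isolate_free \<longleftrightarrow> (\<forall>v\<in>pverts G. open_nbhd v \<noteq> {})"

text \<open>The partially dominated graph with already dominated set \<open>A\<close> is represented by \<open>A\<close> alone.\<close>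

definition has_Z_configuration :: "'a set \<Rightarrow> bool" where
  "has_Z_configuration A \<longleftrightarrow>
     (\<exists>v \<in> pverts G - A. open_nbhd v \<subseteq> A \<and> (\<forall>u \<in> open_nbhd v. card (open_nbhd u - A) \<ge> 2))"

definition Z_insensitive :: bool where
  "Z_insensitive \<longleftrightarrow>
     isolate_free \<and> (\<forall>D \<subseteq> pverts G. \<not> has_Z_configuration (closed_nbhd_set D))"

fun game_nbhd :: "game \<Rightarrow> 'a \<Rightarrow> 'a set" where
  "game_nbhd Domination v = closed_nbhd v"
| "game_nbhd Z_Domination v = open_nbhd v"

text \<open>
  The list \<open>h\<close> consists of the vertices selected so far. In both games a selected vertex dominates
  its closed neighborhood; the games differ only in where a move has to find an undominated vertex.
\<close>

definition legal_moves :: "game \<Rightarrow> 'a list \<Rightarrow> 'a set" where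
  "legal_moves g h = {v \<in> pverts G. game_nbhd g v - closed_nbhd_set (set h) \<noteq> {}}"

text \<open>
  \<open>moves_left g p h\<close> is the number of further moves under optimal play after the moves \<open>h\<close>, when
  player \<open>p\<close> is next to move. The sets under \<^const>\<open>Min\<close> and \<^const>\<open>Max\<close> are finite and nonempty.
\<close>

function moves_left :: "game \<Rightarrow> player \<Rightarrow> 'a list \<Rightarrow> nat" where
  "moves_left g p h =
     (if legal_moves g h = {} then 0
      else 1 + (case p of
        Dominator \<Rightarrow> Min ((\<lambda>v. moves_left g Staller (h @ [v])) ` legal_moves g h)
      | Staller \<Rightarrow> Max ((\<lambda>v. moves_left g Dominator (h @ [v])) ` legal_moves g h)))"
  by pat_completeness auto

lemma card_undominated_decreases:
  assumes "v \<in> legal_moves g h"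
  shows "card (pverts G - closed_nbhd_set (set (h @ [v]))) < card (pverts G - closed_nbhd_set (set h))"
proof (rule psubset_card_mono)
  show "finite (pverts G - closed_nbhd_set (set h))"
    using pair_finite_verts by simp
  obtain w where w: "w \<in> game_nbhd g v" "w \<notin> closed_nbhd_set (set h)" and v: "v \<in> pverts G"
    using assms by (auto simp: legal_moves_def)
  have "w \<in> closed_nbhd v"
    using w(1) by (cases g) (auto simp: closed_nbhd_def)
  moreover from this have "w \<in> pverts G"
    using v by (auto simp: closed_nbhd_def open_nbhd_def dest: in_arcsD2)
  ultimately show "pverts G - closed_nbhd_set (set (h @ [v])) \<subset> pverts G - closed_nbhd_set (set h)"
    using w(2) by (auto simp: closed_nbhd_set_def)
qed

termination
  by (relation "measure (\<lambda>(g, p, h). card (pverts G - closed_nbhd_set (set h)))")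
     (simp_all only: wf_measure in_measure split_conv card_undominated_decreases)

declare moves_left.simps [simp del]

definition \<gamma>\<^sub>g :: nat where
  "\<gamma>\<^sub>g = moves_left Domination Dominator []"

definition \<gamma>\<^sub>g' :: nat where
  "\<gamma>\<^sub>g' = moves_left Domination Staller []"

definition \<gamma>\<^sub>Z\<^sub>g :: nat where
  "\<gamma>\<^sub>Z\<^sub>g = moves_left Z_Domination Dominator []"

definition \<gamma>\<^sub>Z\<^sub>g' :: nat where
  "\<gamma>\<^sub>Z\<^sub>g' = moves_left Z_Domination Staller []"

end

end

theory Submission
  imports Defs
begin

text \<open>
  A position of either game matters only through its set \<open>A\<close> of dominated vertices. A move \<open>v\<close> that is
  legal in the domination game but not in the Z-domination game has \<open>v \<notin> A\<close> and \<open>N(v) \<subseteq> A\<close>, so it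
  dominates \<open>v\<close> alone. Since \<open>G|A\<close> has no Z-configuration, some \<open>u \<in> N(v)\<close> satisfies
  \<open>N(u) - A = {v}\<close>; as \<open>u \<in> A\<close>, the move \<open>u\<close> also dominates \<open>v\<close> alone, and it is Z-legal. So both
  games offer the same successor sets at every position.
\<close>

context pair_graph
begin

lemma open_nbhd_sym: "u \<in> open_nbhd v \<longleftrightarrow> v \<in> open_nbhd u"
  by (auto simp: open_nbhd_def intro: arcs_symmetric)

lemma open_nbhd_subset: "open_nbhd v \<subseteq> pverts G"
  by (auto simp: open_nbhd_def dest: in_arcsD2)

lemma finite_open_nbhd: "finite (open_nbhd v)"
  using open_nbhd_subset pair_finite_verts by (rule finite_subset)

lemma closed_nbhd_set_insert: "closed_nbhd_set (insert v D) = closed_nbhd v \<union> closed_nbhd_set D"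
  by (simp add: closed_nbhd_set_def)

lemma open_nbhd_subset_closed_nbhd: "open_nbhd v \<subseteq> closed_nbhd v"
  by (auto simp: closed_nbhd_def)

lemma ex_Z_legal_same_effect:
  assumes "\<not> has_Z_configuration A"
    and "v \<in> pverts G" "closed_nbhd v - A \<noteq> {}"
  shows "\<exists>u\<in>pverts G. open_nbhd u - A \<noteq> {} \<and> closed_nbhd u \<union> A = closed_nbhd v \<union> A"
proof (cases "open_nbhd v \<subseteq> A")
  case False
  then show ?thesis using assms(2) by blast
next
  case True
  then have "v \<in> pverts G - A"
    using assms(2,3) by (auto simp: closed_nbhd_def)
  with True assms(1) obtain u where u: "u \<in> open_nbhd v" "\<not> card (open_nbhd u - A) \<ge> 2"
    unfolding has_Z_configuration_def by blast
  have v: "v \<in> open_nbhd u - A"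
    using u(1) open_nbhd_sym \<open>v \<in> pverts G - A\<close> by blast
  have "card (open_nbhd u - A) \<le> Suc 0"
    using u(2) by linarith
  then have "open_nbhd u - A = {v}"
    using v finite_open_nbhd by (auto simp: card_le_Suc0_iff_eq)
  \<comment> \<open>Both sides are \<open>A\<close> together with \<open>v\<close>: the vertex
    \<open>u\<close> lies in N(v), hence in \<open>A\<close>.\<close>
  then have "closed_nbhd u \<union> A = closed_nbhd v \<union> A"
    using True u(1) by (auto simp: closed_nbhd_def)
  then show ?thesis
    using u(1) v open_nbhd_subset by blast
qed

text \<open>The vertex from \<open>ex_Z_legal_same_effect\<close> has an undominated neighbor, so it
  is legal in both games. Hence \<open>g\<close> and \<open>g'\<close> can be arbitrary, and one
  lemma serves both directions of the simulation.\<close>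

lemma legal_move_transfer:
  assumes "\<not> has_Z_configuration (closed_nbhd_set (set h))"
    and "closed_nbhd_set (set h) = closed_nbhd_set (set h')"
    and "v \<in> legal_moves g h"
  shows "\<exists>v'\<in>legal_moves g' h'.
    closed_nbhd_set (set (h @ [v])) = closed_nbhd_set (set (h' @ [v']))"
proof -
  let ?A = "closed_nbhd_set (set h)"
  have v: "v \<in> pverts G" "closed_nbhd v - ?A \<noteq> {}"
    using assms(3) open_nbhd_subset_closed_nbhd[of v] by (cases g; auto simp: legal_moves_def)+
  obtain u where u: "u \<in> pverts G" "open_nbhd u - ?A \<noteq> {}"
      "closed_nbhd u \<union> ?A = closed_nbhd v \<union> ?A"
    using ex_Z_legal_same_effect[OF assms(1) v] by blast
  have "u \<in> legal_moves g' h'"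
    using u(1,2) assms(2) open_nbhd_subset_closed_nbhd[of u]
    by (cases g') (auto simp: legal_moves_def)
  then show ?thesis
    using u(3) assms(2) by (auto simp: closed_nbhd_set_insert)
qed

text \<open>Matching moves may be different vertices, so the histories diverge; the invariant of the
  induction is that their dominated sets agree. The inclusions in \<open>pverts G\<close> let
  Z-insensitivity apply with the played vertices as D.\<close>

lemma moves_left_cong:
  assumes "Z_insensitive"
    and "set h \<subseteq> pverts G" "set h' \<subseteq> pverts G"
    and "closed_nbhd_set (set h) = closed_nbhd_set (set h')"
  shows "moves_left g p h = moves_left g' p h'"
  using assms(2-)
proof (induction g p h arbitrary: g' h' rule: moves_left.induct)
  case (1 g p h)
  have noZ: "\<not> has_Z_configuration (closed_nbhd_set (set h))"
    using assms(1) 1(3) by (simp add: Z_insensitive_def)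
  \<comment> \<open>The induction gives one hypothesis per player; letting \<open>q\<close> be the
    opponent of \<open>p\<close> merges them.\<close>
  have IH: "moves_left g q (h @ [v]) = moves_left g' q (h' @ [v'])"
    if "v \<in> legal_moves g h" "v' \<in> legal_moves g' h'"
      "closed_nbhd_set (set (h @ [v])) = closed_nbhd_set (set (h' @ [v']))"
      "q = (case p of Dominator \<Rightarrow> Staller | Staller \<Rightarrow> Dominator)" for v v' q
  proof -
    have ne: "legal_moves g h \<noteq> {}"
      using that(1) by blast
    have sub: "set (h @ [v]) \<subseteq> pverts G" "set (h' @ [v']) \<subseteq> pverts G"
      using that(1,2) 1(3,4) by (auto simp: legal_moves_def)
    show ?thesis
    proof (cases p)
      case Dominator
      then show ?thesis
        using 1(1)[OF ne Dominator that(1) sub that(3)] that(4) by simp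
    next
      case Staller
      then show ?thesis
        using 1(2)[OF ne Staller that(1) sub that(3)] that(4) by simp
    qed
  qed
  have fwd: "\<exists>v'\<in>legal_moves g' h'.
      closed_nbhd_set (set (h @ [v])) = closed_nbhd_set (set (h' @ [v']))"
    if "v \<in> legal_moves g h" for v
    using legal_move_transfer[OF noZ 1(5) that] .
  have bwd: "\<exists>v\<in>legal_moves g h.
      closed_nbhd_set (set (h @ [v])) = closed_nbhd_set (set (h' @ [v']))"
    if "v' \<in> legal_moves g' h'" for v'
    using legal_move_transfer[OF noZ[unfolded 1(5)] 1(5)[symmetric] that] by (simp only: eq_commute)
  have empty: "legal_moves g h = {} \<longleftrightarrow> legal_moves g' h' = {}"
    using fwd bwd by blast
  \<comment> \<open>The sets of legal moves may differ, but matching in both directions makes the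
    sets of resulting values equal, so their \<open>Min\<close> and \<open>Max\<close>
    agree.\<close>
  have "(\<lambda>v. moves_left g q (h @ [v])) ` legal_moves g h
      = (\<lambda>v. moves_left g' q (h' @ [v])) ` legal_moves g' h'"
    if q: "q = (case p of Dominator \<Rightarrow> Staller | Staller \<Rightarrow> Dominator)" for q
  proof (intro equalityI image_subsetI)
    fix v assume v: "v \<in> legal_moves g h"
    show "moves_left g q (h @ [v]) \<in> (\<lambda>v. moves_left g' q (h' @ [v])) ` legal_moves g' h'"
      using fwd[OF v] IH[OF v _ _ q] by blast
  next
    fix v' assume v': "v' \<in> legal_moves g' h'"
    show "moves_left g' q (h' @ [v']) \<in> (\<lambda>v. moves_left g q (h @ [v])) ` legal_moves g h"
      using bwd[OF v'] IH[OF _ v' _ q, symmetric] by blast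
  qed
  then show ?case
    using empty by (cases p) (simp_all add: moves_left.simps[of g _ h] moves_left.simps[of g' _ h'])
qed

end

theorem theorem4p1:
  fixes G :: "'a pair_pre_digraph"
  assumes "pair_graph G"
    and "pair_graph.Z_insensitive G"
  shows "pair_graph.\<gamma>\<^sub>Z\<^sub>g G = pair_graph.\<gamma>\<^sub>g G \<and> pair_graph.\<gamma>\<^sub>Z\<^sub>g' G = pair_graph.\<gamma>\<^sub>g' G"
proof -
  interpret pair_graph G by fact
  show ?thesis
    unfolding \<gamma>\<^sub>Z\<^sub>g_def \<gamma>\<^sub>g_def \<gamma>\<^sub>Z\<^sub>g'_def \<gamma>\<^sub>g'_def
    by (intro conjI moves_left_cong[OF assms(2)]) simp_all
qed

end
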